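(* Let $n\ge 1$ be an integer, let $\alpha\in(0,2)$, and let $f,g\in C^1([0,+\infty)\times[0,+\infty),\mathbb{R})$. Let $u,v\in L_\alpha\cap C^{1,1}_{loc}(\mathbb{R}^n)$ be a positive solution of the system $$(-\Delta)^{\alpha/2}u(x)=f(u(x),v(x)),\quad (-\Delta)^{\alpha/2}v(x)=g(u(x),v(x)),\quad u(x)>0,\ v(x)>0,\qquad x\in\mathbb{R}^n.$$ Let $a,b>0$ and $p,q,r,s\ge 1$ be real numbers and suppose that: (i) $u(x)\lesssim |x|^{-a}$ and $v(x)\lesssim |x|^{-b}$ as $|x|\to\infty$; (ii) $\frac{\partial f}{\partial u}(u,v)\lesssim u^{p-1}v^{q}$ and $\frac{\partial g}{\partial v}(u,v)\lesssim u^{r}v^{s-1}$ as $(u,v)\to(0^+,0^+)$; (iii) $\frac{\partial f}{\partial v}(u,v)\lesssim u^{p}v^{q-1}$ and $\frac{\partial g}{\partial u}(u,v)\lesssim u^{r-1}v^{s}$ as $(u,v)\to(0^+,0^+)$; (iv) $\frac{\partial f}{\partial v}(u,v)>0$ and $\frac{\partial g}{\partial u}(u,v)>0$ for all $(u,v)\in(0,\infty)\times(0,\infty)$; (v) $\alpha<\min\{ap+bq-a,\ ap+bq-b,\ ar+bs-a,\ ar+bs-b\}$. Then there exists a constant $R_0>0$ such that for every $\lambda\le 0$: (a) if there is $x^*\in\Sigma_\lambda$ with $|x^*|>R_0$ and $U_\lambda(x^* )=\min_{x\in\overline{\Sigma_\lambda}}U_\lambda(x)<0$, then $V_\lambda(x^*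 )<2U_\lambda(x^* )<0$; (b) if there is $y^*\in\Sigma_\lambda$ with $|y^*|>R_0$ and $V_\lambda(y^* )=\min_{y\in\overline{\Sigma_\lambda}}V_\lambda(y)<0$, then $U_\lambda(y^* )<2V_\lambda(y^* )<0$.
   Context: For $\alpha\in(0,2)$, the fractional Laplacian is $$(-\Delta)^{\alpha/2}u(x)=C_{n,\alpha}\lim_{\epsilon\to0}\int_{\mathbb{R}^n\setminus B_\epsilon(x)}\frac{u(x)-u(y)}{|x-y|^{n+\alpha}}\,dy,$$ where $C_{n,\alpha}>0$ is a normalization constant. $L_\alpha$ is the set of functions $u:\mathbb{R}^n\to\mathbb{R}$ with $\int_{\mathbb{R}^n}\frac{|u(x)|}{1+|x|^{n+\alpha}}dx<+\infty$. $C^{1,1}_{loc}(\mathbb{R}^n)$ is the set of $C^1$ functions with locally Lipschitz gradient. For $u\in L_\alpha\cap C^{1,1}_{loc}(\mathbb{R}^n)$ the limit as $\epsilon\to0$ defining $(-\Delta)^{\alpha/2}u(x)$ is well defined at every point, and equations are understood pointwise. The notation $A\lesssim B$ in a limit means that $A\le B$ (with constant 1) sufficiently near the limit: $u(x)\lesssim|x|^{-a}$ as $|x|\to\infty$ means there is $R>0$ with $u(x)\le|x|^{-a}$ for all $|x|>R$; $A(u,v)\lesssim B(u,v)$ as $(u,v)\to(0^+,0^+)$ means there is $\delta>0$ with $A(u,v)\le B(u,v)$ for all $u,v>0$ with $u+v<\delta$. Moving-plane notation: write $x=(x_1,x')$ with $x'\in\mathbb{R}^{n-1}$ (the $x_1$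 direction may be any chosen direction). For $\lambda\in\mathbb{R}$ let $\Sigma_\lambda=\{x\in\mathbb{R}^n: x_1<\lambda\}$, let $x^\lambda=(2\lambda-x_1,x')$ be the reflection of $x$ in the hyperplane $\{x_1=\lambda\}$, and set $$U_\lambda(x)=u(x^\lambda)-u(x),\qquad V_\lambda(x)=v(x^\lambda)-v(x).$$ *)

theory Defs
  imports "HOL-Analysis.Analysis"
begin

text \<open>
  The positive normalization constant of the fractional Laplacian is the parameter \<open>C\<close>; no
  particular normalization is singled out. The value is only meaningful where the limit exists,
  which is the case for functions in \<open>L_space \<alpha>\<close> satisfying \<open>C11_loc\<close>.
\<close>

definition frac_laplacian :: "real \<Rightarrow> real \<Rightarrow> (real ^ 'n \<Rightarrow> real) \<Rightarrow> real ^ 'n \<Rightarrow> real" where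
  "frac_laplacian C \<alpha> u x =
     C * Lim (at_right 0) (\<lambda>\<epsilon>. LINT y:(- ball x \<epsilon>)|lebesgue.
           (u x - u y) / norm (x - y) powr (real CARD('n) + \<alpha>))"

definition L_space :: "real \<Rightarrow> (real ^ 'n \<Rightarrow> real) set" where
  "L_space \<alpha> = {u \<in> borel_measurable lebesgue.
     (\<integral>\<^sup>+ x. ennreal (\<bar>u x\<bar> / (1 + norm x powr (real CARD('n) + \<alpha>))) \<partial>lebesgue) < \<infinity>}"

text \<open>Continuity of the gradient need not be required: it follows from the Lipschitz condition.\<close>

definition C11_loc :: "(real ^ 'n \<Rightarrow> real) \<Rightarrow> bool" where
  "C11_loc u \<longleftrightarrow> (\<exists>G. (\<forall>x. GDERIV u x :> G x) \<and>
     (\<forall>x. \<exists>r>0. \<exists>L. L-lipschitz_on (cball x r) G))"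

text \<open>
  On a set that is not open, such as the closed quadrant, differentiability is taken relative to
  the set, so at boundary points it is one-sided and values outside the set are irrelevant.
\<close>

definition C1_on :: "'a::real_normed_vector set \<Rightarrow> ('a \<Rightarrow> 'b::real_normed_vector) \<Rightarrow> bool" where
  "C1_on S f \<longleftrightarrow> (\<exists>f'. (\<forall>x\<in>S. (f has_derivative blinfun_apply (f' x)) (at x within S)) \<and>
     continuous_on S f')"

definition partial1 :: "(real \<Rightarrow> real \<Rightarrow> real) \<Rightarrow> real \<Rightarrow> real \<Rightarrow> real" where
  "partial1 f u v = deriv (\<lambda>t. f t v) u"

definition partial2 :: "(real \<Rightarrow> real \<Rightarrow> real) \<Rightarrow> real \<Rightarrow> real \<Rightarrow> real" where
  "partial2 f u v = deriv (\<lambda>t. f u t) v"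

text \<open>The two \<open>lesssim\<close> relations have constant 1, not an arbitrary multiplicative constant.\<close>

definition lesssim_infinity :: "('a::real_normed_vector \<Rightarrow> real) \<Rightarrow> ('a \<Rightarrow> real) \<Rightarrow> bool" where
  "lesssim_infinity A B \<longleftrightarrow> (\<exists>R>0. \<forall>x. norm x > R \<longrightarrow> A x \<le> B x)"

definition lesssim_origin :: "(real \<Rightarrow> real \<Rightarrow> real) \<Rightarrow> (real \<Rightarrow> real \<Rightarrow> real) \<Rightarrow> bool" where
  "lesssim_origin A B \<longleftrightarrow> (\<exists>\<delta>>0. \<forall>u>0. \<forall>v>0. u + v < \<delta> \<longrightarrow> A u v \<le> B u v)"

text \<open>
  Moving planes in the direction of a unit vector \<open>e\<close>, with \<open>x \<bullet> e\<close> in the role of the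
  coordinate \<open>x\<^sub>1\<close>.
\<close>

definition halfspace :: "real ^ 'n \<Rightarrow> real \<Rightarrow> (real ^ 'n) set" where
  "halfspace e l = {x. x \<bullet> e < l}"

definition reflect :: "real ^ 'n \<Rightarrow> real \<Rightarrow> real ^ 'n \<Rightarrow> real ^ 'n" where
  "reflect e l x = x + (2 * (l - x \<bullet> e)) *\<^sub>R e"

definition refl_diff :: "real ^ 'n \<Rightarrow> real \<Rightarrow> (real ^ 'n \<Rightarrow> real) \<Rightarrow> real ^ 'n \<Rightarrow> real" where
  "refl_diff e l u x = u (reflect e l x) - u x"

end

theory Submission
  imports Defs
begin

text \<open>
  Let \<open>U = refl_diff e l u\<close>, \<open>V = refl_diff e l v\<close>, and let \<open>x\<close> be a far away point of the half-space
  at which \<open>U\<close> has a negative minimum. The claim \<open>V x < 2 * U x\<close> comes from comparing two bounds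
  for the difference of the fractional Laplacian of \<open>u\<close> at the mirror image of \<open>x\<close> and at \<open>x\<close>.

  The nonlocal operator bounds this difference from above. Since \<open>U\<close> is odd under the reflection, the
  integral defining the difference folds onto the half-space, and minimality of \<open>U x\<close> leaves at most
  \<open>\<kappa> * d powr - \<alpha> * U x\<close> with \<open>\<kappa> > 0\<close> and \<open>d\<close> the distance of \<open>x\<close> to the mirror
  (\<open>frac_laplacian_reflected_difference_le\<close>). As \<open>l \<le> 0\<close>, \<open>d \<le> norm x\<close>, so the bound is
  \<open>\<kappa> * norm x powr - \<alpha> * U x\<close>.

  The equation identifies the same difference with the increment of \<open>f\<close> between the pairs of values of
  \<open>(u, v)\<close> at the two points. If \<open>V x \<ge> 2 * U x\<close>, the mean value theorem, the growth bounds of the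
  partial derivatives and the monotonicity of \<open>f\<close> in its second argument bound this increment from below
  by \<open>U x\<close> times a sum of two products of powers of \<open>u x\<close> and \<open>v x\<close>
  (\<open>reaction_difference_lower_bound\<close>). Because \<open>u\<close> and \<open>v\<close> decay, that sum is a combination of powers of
  \<open>norm x\<close> which the exponent condition makes smaller than \<open>\<kappa> * norm x powr - \<alpha>\<close> once \<open>norm x\<close> is
  large. With \<open>U x < 0\<close> the two bounds contradict each other (\<open>decay_forces_partner_below\<close>). The second
  half of the theorem is the first one with the two components exchanged.

  The analytic groundwork is what makes the operator usable: the truncated integrals converge as the
  truncation radius tends to \<open>0\<close>, because the linear part of the Taylor expansion is odd and integrates to zero, while
  the quadratic remainder makes the singularity integrable (\<open>pv_limit_exists\<close>); and Lebesgue measure is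
  invariant under reflections (\<open>lborel_distr_rigid_motion\<close>).
\<close>

section \<open>Invariance of Lebesgue measure and integrability of powers of the distance\<close>

text \<open>
  This is the uniqueness argument for Haar measure. For a Borel set \<open>A\<close> and the unit ball \<open>B\<close>, the double
  integral of \<open>indicator A x * indicator B (x - T y)\<close> is computed in both orders. Integrating over \<open>y\<close> first
  gives the measure of \<open>A\<close> times that of \<open>B\<close>, as \<open>T\<close> preserves the norm; substituting
  \<open>x\<close> by \<open>T y + x\<close> and then integrating over \<open>y\<close> first gives the measure of \<open>T -` A\<close> times that of \<open>B\<close>.
\<close>

lemma lborel_distr_orthogonal:
  fixes T :: "'a::euclidean_space \<Rightarrow> 'a"
  assumes T: "orthogonal_transformation T"
  shows "distr lborel borel T = lborel"
proof (rule measure_eqI)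
  fix A :: "'a set" assume "A \<in> sets (distr lborel borel T)"
  then have A [measurable]: "A \<in> sets borel" by simp
  have lin: "linear T" using T by (rule orthogonal_transformation_linear)
  have T_meas [measurable]: "T \<in> borel \<rightarrow>\<^sub>M borel"
    by (intro borel_measurable_continuous_onI linear_continuous_on linear_conv_bounded_linear[THEN iffD1] lin)
  have [measurable]: "ball (0::'a) 1 \<in> sets borel" by simp
  let ?I = "\<lambda>x y. indicator A x * indicator (ball 0 1) (x - T y) :: ennreal"
  have unit: "emeasure lborel (ball z 1) = emeasure lborel (ball (0::'a) 1)" for z :: 'a
    by (simp add: emeasure_ball)
  have "(\<integral>\<^sup>+x. (\<integral>\<^sup>+y. ?I x y \<partial>lborel) \<partial>lborel) = (\<integral>\<^sup>+x. indicator A x * emeasure lborel (ball (0::'a) 1) \<partial>lborel)"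
  proof (intro nn_integral_cong)
    fix x :: 'a
    obtain z where z: "x = T z" using orthogonal_transformation_surj[OF T] by (metis surjE)
    have "indicator (ball 0 1) (x - T y) = (indicator (ball z 1) y :: ennreal)" for y
    proof -
      have "norm (T z - T y) = dist z y"
        using orthogonal_transformation_norm[OF T, of "z - y"] by (metis dist_norm linear_diff[OF lin])
      then show ?thesis by (simp add: z indicator_def)
    qed
    then show "(\<integral>\<^sup>+y. ?I x y \<partial>lborel) = indicator A x * emeasure lborel (ball (0::'a) 1)"
      by (simp add: nn_integral_cmult_indicator unit[of z])
  qed
  also have "\<dots> = emeasure lborel A * emeasure lborel (ball (0::'a) 1)"
    by (simp add: nn_integral_multc)
  finally have 1: "(\<integral>\<^sup>+x. (\<integral>\<^sup>+y. ?I x y \<partial>lborel) \<partial>lborel) = emeasure lborel A * emeasure lborel (ball (0::'a) 1)" .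
  have shift: "(\<integral>\<^sup>+x. h x \<partial>lborel) = (\<integral>\<^sup>+x. h (c + x) \<partial>lborel)"
    if "h \<in> borel_measurable borel" for h :: "'a \<Rightarrow> ennreal" and c
  proof -
    have "(\<integral>\<^sup>+x. h x \<partial>distr lborel borel ((+) c)) = (\<integral>\<^sup>+x. h (c + x) \<partial>lborel)"
      using that by (intro nn_integral_distr) auto
    then show ?thesis by (simp add: lborel_distr_plus)
  qed
  have "(\<integral>\<^sup>+x. (\<integral>\<^sup>+y. ?I x y \<partial>lborel) \<partial>lborel) = (\<integral>\<^sup>+y. (\<integral>\<^sup>+x. ?I x y \<partial>lborel) \<partial>lborel)"
    by (rule lborel_pair.Fubini') measurable
  also have "\<dots> = (\<integral>\<^sup>+y. (\<integral>\<^sup>+x. indicator A (T y + x) * indicator (ball 0 1) x \<partial>lborel) \<partial>lborel)"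
  proof (rule nn_integral_cong)
    fix y :: 'a
    have "(\<integral>\<^sup>+x. ?I x y \<partial>lborel) = (\<integral>\<^sup>+x. ?I (T y + x) y \<partial>lborel)"
      by (rule shift) measurable
    then show "(\<integral>\<^sup>+x. ?I x y \<partial>lborel) = (\<integral>\<^sup>+x. indicator A (T y + x) * indicator (ball 0 1) x \<partial>lborel)"
      by (simp only: add_diff_cancel_left')
  qed
  also have "\<dots> = (\<integral>\<^sup>+x. (\<integral>\<^sup>+y. indicator A (T y + x) * indicator (ball 0 1) x \<partial>lborel) \<partial>lborel)"
    by (rule lborel_pair.Fubini') measurable
  also have "\<dots> = (\<integral>\<^sup>+x. emeasure lborel (T -` A) * indicator (ball (0::'a) 1) x \<partial>lborel)"
  proof (intro nn_integral_cong)
    fix x :: 'a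
    obtain z where z: "x = T z" using orthogonal_transformation_surj[OF T] by (metis surjE)
    have "(\<integral>\<^sup>+y. indicator A (T y + x) \<partial>lborel) = (\<integral>\<^sup>+y. indicator (T -` A) (z + y) \<partial>lborel)"
      by (intro nn_integral_cong) (simp add: z linear_add[OF lin] add.commute indicator_def)
    also have "\<dots> = (\<integral>\<^sup>+y. indicator (T -` A) y \<partial>lborel)"
      by (rule shift[symmetric]) (use measurable_sets[OF T_meas A] in simp)
    also have "\<dots> = emeasure lborel (T -` A)"
      using measurable_sets[OF T_meas A] by (simp)
    finally show "(\<integral>\<^sup>+y. indicator A (T y + x) * indicator (ball 0 1) x \<partial>lborel)
       = emeasure lborel (T -` A) * indicator (ball 0 1) x"
      by (subst nn_integral_multc) auto
  qed
  also have "\<dots> = emeasure lborel (T -` A) * emeasure lborel (ball (0::'a) 1)"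
    by (simp add: nn_integral_cmult)
  finally have "emeasure lborel A * emeasure lborel (ball (0::'a) 1)
      = emeasure lborel (T -` A) * emeasure lborel (ball (0::'a) 1)"
    unfolding 1 .
  moreover have "emeasure lborel (ball (0::'a) 1) \<noteq> 0" "emeasure lborel (ball (0::'a) 1) \<noteq> top"
    by (simp_all add: emeasure_ball ennreal_eq_0_iff not_le)
  ultimately have "emeasure lborel A = emeasure lborel (T -` A)"
    by (metis ennreal_mult_divide_eq)
  then show "emeasure (distr lborel borel T) A = emeasure lborel A"
    by (simp add: emeasure_distr)
qed simp

lemma lborel_distr_rigid_motion:
  fixes T :: "'a::euclidean_space \<Rightarrow> 'a"
  assumes T: "orthogonal_transformation T"
  shows "distr lborel borel (\<lambda>y. c + T y) = lborel"
proof -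
  have [measurable]: "T \<in> borel \<rightarrow>\<^sub>M borel"
    by (intro borel_measurable_continuous_onI linear_continuous_on linear_conv_bounded_linear[THEN iffD1]
        orthogonal_transformation_linear T)
  have "distr lborel borel (\<lambda>y. c + T y) = distr (distr lborel borel T) borel ((+) c)"
    by (subst distr_distr) (auto simp: o_def)
  then show ?thesis by (simp add: lborel_distr_orthogonal[OF T] lborel_distr_plus)
qed

text \<open>
  On the shell where the distance to \<open>x\<close> lies between \<open>\<sigma>\<close> and \<open>2 * \<sigma>\<close>, the integrand is comparable to
  \<open>\<sigma> powr - \<beta>\<close> and the volume is at most a multiple of \<open>\<sigma> powr DIM('a)\<close>. Hence the shells with \<open>\<sigma> = \<rho> * t ^ k\<close>
  contribute a geometric series with ratio \<open>t powr (DIM('a) - \<beta>)\<close>. Taking \<open>t = 2\<close> treats the neighbourhood of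
  infinity and \<open>t = 1/2\<close> the neighbourhood of \<open>x\<close>.
\<close>

lemma nn_integral_dyadic_shells_finite:
  fixes x :: "'a::euclidean_space"
  assumes \<rho>: "\<rho> > 0" and t: "t > 0" and small: "t powr (real DIM('a) - \<beta>) < 1"
    and A: "A \<subseteq> (\<Union>k. {y. \<rho> * t ^ k \<le> dist x y \<and> dist x y < 2 * (\<rho> * t ^ k)})"
    and [measurable]: "A \<in> sets borel"
  shows "(\<integral>\<^sup>+y\<in>A. ennreal (dist x y powr - \<beta>) \<partial>lborel) < \<infinity>"
proof -
  let ?n = "real DIM('a)"
  let ?S = "\<lambda>k. {y. \<rho> * t ^ k \<le> dist x y \<and> dist x y < 2 * (\<rho> * t ^ k)}"
  \<comment> \<open>\<open>M\<close> covers both signs of \<open>\<beta>\<close>: in dimension one the exponent \<open>\<beta>\<close> can be negative near the singularity,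
    and then the larger end of the shell dominates.\<close>
  define M where "M = max 1 (2 powr - \<beta>)"
  define D where "D = M * unit_ball_vol ?n * 2 powr ?n * \<rho> powr (?n - \<beta>)"
  define \<theta> where "\<theta> = t powr (?n - \<beta>)"
  have shell: "(\<integral>\<^sup>+y. ennreal (dist x y powr - \<beta>) * indicator (?S k) y \<partial>lborel) \<le> ennreal (D * \<theta> ^ k)" for k
  proof -
    define \<sigma> where "\<sigma> = \<rho> * t ^ k"
    have \<sigma>: "\<sigma> > 0" using \<rho> t by (simp add: \<sigma>_def)
    have pt: "dist x y powr - \<beta> \<le> M * \<sigma> powr - \<beta>" if "\<sigma> \<le> dist x y" "dist x y < 2 * \<sigma>" for y
    proof (cases "\<beta> \<ge> 0")
      case True
      have "dist x y powr - \<beta> \<le> 1 * \<sigma> powr - \<beta>"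
        using that \<sigma> True by (simp add: powr_mono2')
      also have "\<dots> \<le> M * \<sigma> powr - \<beta>" by (intro mult_right_mono) (auto simp: M_def)
      finally show ?thesis .
    next
      case False
      have "dist x y powr - \<beta> \<le> (2 * \<sigma>) powr - \<beta>"
        using that \<sigma> False by (intro powr_mono2) auto
      also have "\<dots> = 2 powr - \<beta> * \<sigma> powr - \<beta>" using \<sigma> by (simp add: powr_mult)
      also have "\<dots> \<le> M * \<sigma> powr - \<beta>" by (intro mult_right_mono) (auto simp: M_def)
      finally show ?thesis .
    qed
    have "(\<integral>\<^sup>+y. ennreal (dist x y powr - \<beta>) * indicator (?S k) y \<partial>lborel)
       \<le> (\<integral>\<^sup>+y. ennreal (M * \<sigma> powr - \<beta>) * indicator (ball x (2 * \<sigma>)) y \<partial>lborel)"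
      using pt by (intro nn_integral_mono) (auto simp: indicator_def \<sigma>_def[symmetric] intro!: ennreal_leI)
    also have "\<dots> = ennreal (M * \<sigma> powr - \<beta>) * ennreal (unit_ball_vol ?n * (2 * \<sigma>) ^ DIM('a))"
      using \<sigma> by (subst nn_integral_cmult_indicator) (auto simp: emeasure_ball)
    also have "\<dots> = ennreal (M * \<sigma> powr - \<beta> * (unit_ball_vol ?n * (2 * \<sigma>) powr ?n))"
      using \<sigma> by (subst ennreal_mult) (auto simp: M_def powr_realpow)
    also have "M * \<sigma> powr - \<beta> * (unit_ball_vol ?n * (2 * \<sigma>) powr ?n)
        = M * unit_ball_vol ?n * 2 powr ?n * \<sigma> powr (?n - \<beta>)"
      using \<sigma> by (simp add: powr_mult powr_diff powr_minus field_simps)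
    also have "\<sigma> powr (?n - \<beta>) = \<rho> powr (?n - \<beta>) * \<theta> ^ k"
      using \<rho> t by (simp add: \<sigma>_def \<theta>_def powr_mult powr_powr powr_realpow[symmetric] mult.commute)
    finally show ?thesis by (simp add: D_def mult.assoc)
  qed
  have "(\<integral>\<^sup>+y\<in>A. ennreal (dist x y powr - \<beta>) \<partial>lborel)
     \<le> (\<integral>\<^sup>+y. (\<Sum>k. ennreal (dist x y powr - \<beta>) * indicator (?S k) y) \<partial>lborel)"
  proof (intro nn_integral_mono)
    fix y
    show "ennreal (dist x y powr - \<beta>) * indicator A y \<le> (\<Sum>k. ennreal (dist x y powr - \<beta>) * indicator (?S k) y)"
    proof (cases "y \<in> A")
      case True
      then obtain k where k: "y \<in> ?S k" using A by blast
      define h where "h k = ennreal (dist x y powr - \<beta>) * indicator (?S k) y" for k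
      have "(\<Sum>k\<in>{k}. h k) \<le> (\<Sum>k. h k)" by (rule sum_le_suminf) auto
      with k True show ?thesis by (simp add: h_def)
    qed simp
  qed
  also have "\<dots> = (\<Sum>k. \<integral>\<^sup>+y. ennreal (dist x y powr - \<beta>) * indicator (?S k) y \<partial>lborel)"
    by (rule nn_integral_suminf) measurable
  also have "\<dots> \<le> (\<Sum>k. ennreal (D * \<theta> ^ k))"
    by (intro suminf_le shell summableI)
  also have "\<dots> < \<infinity>"
  proof -
    have "0 \<le> D" by (auto simp: D_def M_def)
    moreover have "0 \<le> \<theta>" "\<theta> < 1" using small by (auto simp: \<theta>_def)
    ultimately have "(\<Sum>k. ennreal (D * \<theta> ^ k)) = ennreal (\<Sum>k. D * \<theta> ^ k)"
      by (intro suminf_ennreal2 summable_mult summable_geometric) auto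
    then show ?thesis by simp
  qed
  finally show ?thesis .
qed

lemma integrable_dist_powr_outside_ball:
  fixes x :: "'a::euclidean_space"
  assumes \<epsilon>: "\<epsilon> > 0" and \<beta>: "\<beta> > real DIM('a)"
  shows "integrable lborel (\<lambda>y. indicator (- ball x \<epsilon>) y * dist x y powr - \<beta>)"
proof (rule integrableI_bounded)
  have [measurable]: "ball x \<epsilon> \<in> sets borel" by simp
  show "(\<lambda>y. indicator (- ball x \<epsilon>) y * dist x y powr - \<beta>) \<in> borel_measurable lborel"
    by measurable
  have cover: "\<exists>k. \<epsilon> * 2 ^ k \<le> d \<and> d < 2 * (\<epsilon> * 2 ^ k)" if d: "d \<ge> \<epsilon>" for d :: real
  proof -
    obtain m where "d / \<epsilon> < 2 ^ m" using real_arch_pow[of 2 "d / \<epsilon>"] by auto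
    then have ex: "\<exists>m. d < \<epsilon> * 2 ^ m" using \<epsilon> by (auto simp: field_simps)
    define k where "k = (LEAST m. d < \<epsilon> * 2 ^ m)"
    have k: "d < \<epsilon> * 2 ^ k" using LeastI_ex[OF ex] by (simp add: k_def)
    then obtain j where j: "k = Suc j" using d by (cases k) auto
    have "\<not> d < \<epsilon> * 2 ^ j" using not_less_Least[of j "\<lambda>m. d < \<epsilon> * 2 ^ m"] j by (simp add: k_def)
    with k j show ?thesis by (intro exI[of _ j]) (auto simp: algebra_simps)
  qed
  have "(\<integral>\<^sup>+y\<in>- ball x \<epsilon>. ennreal (dist x y powr - \<beta>) \<partial>lborel) < \<infinity>"
  proof (rule nn_integral_dyadic_shells_finite[where \<rho> = \<epsilon> and t = 2])
    show "2 powr (real DIM('a) - \<beta>) < 1" using \<beta> by (intro powr_less_one) auto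
  qed (use \<epsilon> cover in auto)
  moreover have "(\<integral>\<^sup>+y. ennreal (norm (indicator (- ball x \<epsilon>) y * dist x y powr - \<beta>)) \<partial>lborel)
    = (\<integral>\<^sup>+y\<in>- ball x \<epsilon>. ennreal (dist x y powr - \<beta>) \<partial>lborel)"
    by (intro nn_integral_cong) (auto simp: indicator_def)
  ultimately show "(\<integral>\<^sup>+y. ennreal (norm (indicator (- ball x \<epsilon>) y * dist x y powr - \<beta>)) \<partial>lborel) < \<infinity>"
    by simp
qed

lemma integrable_dist_powr_ball:
  fixes x :: "'a::euclidean_space"
  assumes r: "r > 0" and \<beta>: "\<beta> < real DIM('a)"
  shows "integrable lborel (\<lambda>y. indicator (ball x r) y * dist x y powr - \<beta>)"
proof (rule integrableI_bounded)
  have [measurable]: "ball x r \<in> sets borel" by simp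
  show "(\<lambda>y. indicator (ball x r) y * dist x y powr - \<beta>) \<in> borel_measurable lborel"
    by measurable
  have cover: "\<exists>k. r / 2 * (1/2) ^ k \<le> d \<and> d < 2 * (r / 2 * (1/2) ^ k)" if d: "0 < d" "d < r" for d :: real
  proof -
    have ex: "\<exists>m. r * (1/2) ^ m \<le> d"
      using real_arch_pow_inv[of "d / r" "1/2"] d r by (auto simp: field_simps intro: less_imp_le)
    define k where "k = (LEAST m. r * (1/2) ^ m \<le> d)"
    have k: "r * (1/2) ^ k \<le> d" using LeastI_ex[OF ex] by (simp add: k_def)
    then obtain j where j: "k = Suc j" using d by (cases k) auto
    have "\<not> r * (1/2) ^ j \<le> d" using not_less_Least[of j "\<lambda>m. r * (1/2) ^ m \<le> d"] j by (simp add: k_def)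
    with k j show ?thesis by (intro exI[of _ j]) (auto simp: algebra_simps)
  qed
  have "(\<integral>\<^sup>+y\<in>ball x r - {x}. ennreal (dist x y powr - \<beta>) \<partial>lborel) < \<infinity>"
  proof (rule nn_integral_dyadic_shells_finite[where \<rho> = "r / 2" and t = "1/2"])
    show "(1/2) powr (real DIM('a) - \<beta>) < 1" using \<beta> by (simp add: powr_def mult_pos_neg)
    show "ball x r - {x} \<subseteq> (\<Union>k. {y. r / 2 * (1/2) ^ k \<le> dist x y \<and> dist x y < 2 * (r / 2 * (1/2) ^ k)})"
    proof
      fix y assume "y \<in> ball x r - {x}"
      then show "y \<in> (\<Union>k. {y. r / 2 * (1/2) ^ k \<le> dist x y \<and> dist x y < 2 * (r / 2 * (1/2) ^ k)})"
        using cover[of "dist x y"] by (simp only: UN_iff mem_Collect_eq) auto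
    qed
  qed (use r in auto)
  moreover have "(\<integral>\<^sup>+y. ennreal (norm (indicator (ball x r) y * dist x y powr - \<beta>)) \<partial>lborel)
    = (\<integral>\<^sup>+y\<in>ball x r - {x}. ennreal (dist x y powr - \<beta>) \<partial>lborel)"
    by (intro nn_integral_cong) (auto simp: indicator_def)
  ultimately show "(\<integral>\<^sup>+y. ennreal (norm (indicator (ball x r) y * dist x y powr - \<beta>)) \<partial>lborel) < \<infinity>"
    by simp
qed

section \<open>Existence of the fractional Laplacian\<close>

text \<open>
  The truncated kernel is a function on the whole space, so that indicators and reflections can be moved
  through Lebesgue integrals without set integrals. For continuous \<open>w\<close> it is Borel, which allows the
  replacement of \<open>lebesgue\<close> by \<open>lborel\<close>.
\<close>

definition pv_integrand :: "real \<Rightarrow> ('a::metric_space \<Rightarrow> real) \<Rightarrow> 'a \<Rightarrow> real \<Rightarrow> 'a \<Rightarrow> real" where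
  "pv_integrand \<beta> w x \<epsilon> y = indicator (- ball x \<epsilon>) y * ((w x - w y) / dist x y powr \<beta>)"

lemma pv_integrand_measurable [measurable]:
  fixes w :: "'a::euclidean_space \<Rightarrow> real"
  assumes [measurable]: "w \<in> borel_measurable borel"
  shows "pv_integrand \<beta> w x \<epsilon> \<in> borel_measurable borel"
proof -
  have [measurable]: "ball x \<epsilon> \<in> sets borel" by simp
  show ?thesis unfolding pv_integrand_def by measurable
qed

lemma frac_laplacian_eq_pv_limit:
  fixes w :: "real ^ 'n \<Rightarrow> real"
  assumes [measurable]: "w \<in> borel_measurable borel"
    and lim: "((\<lambda>\<epsilon>. integral\<^sup>L lborel (pv_integrand (real CARD('n) + \<alpha>) w x \<epsilon>)) \<longlongrightarrow> L) (at_right 0)"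
  shows "frac_laplacian C \<alpha> w x = C * L"
proof -
  have "(LINT y:(- ball x \<epsilon>)|lebesgue. (w x - w y) / norm (x - y) powr (real CARD('n) + \<alpha>))
      = integral\<^sup>L lborel (pv_integrand (real CARD('n) + \<alpha>) w x \<epsilon>)" for \<epsilon>
  proof -
    have "(\<lambda>y. indicat_real (- ball x \<epsilon>) y *\<^sub>R ((w x - w y) / norm (x - y) powr (real CARD('n) + \<alpha>)))
        = pv_integrand (real CARD('n) + \<alpha>) w x \<epsilon>"
      by (simp add: pv_integrand_def fun_eq_iff dist_norm)
    then show ?thesis
      unfolding set_lebesgue_integral_def by (simp add: integral_completion)
  qed
  then show ?thesis
    unfolding frac_laplacian_def using tendsto_Lim[OF _ lim] by (simp add: trivial_limit_at_right_real)
qed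

lemma L_space_weighted_integrable:
  fixes w :: "real ^ 'n \<Rightarrow> real"
  assumes w: "w \<in> L_space \<alpha>" and [measurable]: "w \<in> borel_measurable borel"
  shows "integrable lborel (\<lambda>y. w y / (1 + norm y powr (real CARD('n) + \<alpha>)))"
proof (rule integrableI_bounded)
  have "(\<integral>\<^sup>+y. ennreal (\<bar>w y\<bar> / (1 + norm y powr (real CARD('n) + \<alpha>))) \<partial>lborel) < \<infinity>"
    using w by (simp add: L_space_def nn_integral_completion)
  moreover have "\<bar>1 + norm y powr c\<bar> = 1 + norm y powr c" for y :: "real ^ 'n" and c
    by (rule abs_of_nonneg) (simp add: add_nonneg_nonneg)
  ultimately show "(\<integral>\<^sup>+y. ennreal (norm (w y / (1 + norm y powr (real CARD('n) + \<alpha>)))) \<partial>lborel) < \<infinity>"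
    by (simp add: abs_divide)
qed measurable

text \<open>
  Away from \<open>x\<close> the weight \<open>1 + norm y powr \<beta>\<close> is at most a constant times \<open>dist x y powr \<beta>\<close>. So the term \<open>w y\<close>
  is controlled by the weighted integrability of \<open>w\<close>, and the constant \<open>w x\<close> by the integrability of the kernel.
\<close>

lemma pv_integrand_integrable:
  fixes w :: "'a::euclidean_space \<Rightarrow> real"
  assumes w [measurable]: "w \<in> borel_measurable borel"
    and tail: "integrable lborel (\<lambda>y. w y / (1 + norm y powr \<beta>))"
    and \<beta>: "\<beta> > real DIM('a)" and \<epsilon>: "\<epsilon> > 0"
  shows "integrable lborel (pv_integrand \<beta> w x \<epsilon>)"
proof -
  \<comment> \<open>The first summand absorbs the constant \<open>1\<close>, the second one \<open>norm y powr \<beta>\<close>.\<close>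
  define K where "K = \<epsilon> powr - \<beta> + (norm x / \<epsilon> + 1) powr \<beta>"
  have \<beta>0: "\<beta> > 0" using \<beta> by (meson of_nat_0_le_iff order_le_less_trans)
  have weight: "1 + norm y powr \<beta> \<le> K * dist x y powr \<beta>" if d: "\<epsilon> \<le> dist x y" for y
  proof -
    have "\<epsilon> powr \<beta> \<le> dist x y powr \<beta>" using d \<epsilon> \<beta>0 by (intro powr_mono2) auto
    then have "1 \<le> \<epsilon> powr - \<beta> * dist x y powr \<beta>" using \<epsilon> by (simp add: powr_minus field_simps)
    moreover have "norm y powr \<beta> \<le> (norm x / \<epsilon> + 1) powr \<beta> * dist x y powr \<beta>"
    proof -
      have "norm y \<le> norm x + dist x y"
        by (metis dist_commute dist_norm norm_triangle_sub)
      also have "norm x \<le> norm x / \<epsilon> * dist x y"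
        using mult_left_mono[OF d, of "norm x"] \<epsilon> by (simp add: field_simps)
      finally have "norm y \<le> (norm x / \<epsilon> + 1) * dist x y" by (simp add: algebra_simps)
      then have "norm y powr \<beta> \<le> ((norm x / \<epsilon> + 1) * dist x y) powr \<beta>"
        using \<beta>0 by (intro powr_mono2) auto
      then show ?thesis
        using \<epsilon> by (simp add: powr_mult)
    qed
    ultimately show ?thesis by (simp add: K_def algebra_simps)
  qed
  have "integrable lborel (\<lambda>y. \<bar>w x\<bar> * (indicator (- ball x \<epsilon>) y * dist x y powr - \<beta>)
      + K * \<bar>w y / (1 + norm y powr \<beta>)\<bar>)"
    by (intro Bochner_Integration.integrable_add integrable_mult_right integrable_abs
        integrable_dist_powr_outside_ball \<epsilon> \<beta> tail)
  then show ?thesis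
  proof (rule Bochner_Integration.integrable_bound)
    have "norm (pv_integrand \<beta> w x \<epsilon> y) \<le> \<bar>w x\<bar> * (indicator (- ball x \<epsilon>) y * dist x y powr - \<beta>)
      + K * \<bar>w y / (1 + norm y powr \<beta>)\<bar>" for y
    proof (cases "\<epsilon> \<le> dist x y")
      case True
      have pos: "dist x y powr \<beta> > 0" "1 + norm y powr \<beta> > 0"
        using True \<epsilon> by (auto intro: add_pos_nonneg)
      have "\<bar>w x - w y\<bar> / dist x y powr \<beta> \<le> \<bar>w x\<bar> / dist x y powr \<beta> + \<bar>w y\<bar> / dist x y powr \<beta>"
        by (simp add: add_divide_distrib[symmetric] divide_right_mono)
      also have "\<bar>w y\<bar> / dist x y powr \<beta> \<le> K * (\<bar>w y\<bar> / (1 + norm y powr \<beta>))"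
        using mult_left_mono[OF weight[OF True], of "\<bar>w y\<bar>"] pos by (simp add: field_simps)
      finally show ?thesis
        using True by (simp add: pv_integrand_def powr_minus_divide abs_of_pos[OF pos(2)])
    next
      case False
      have "K \<ge> 0" by (simp add: K_def)
      with False show ?thesis by (simp add: pv_integrand_def)
    qed
    then show "AE y in lborel. norm (pv_integrand \<beta> w x \<epsilon> y)
        \<le> norm (\<bar>w x\<bar> * (indicator (- ball x \<epsilon>) y * dist x y powr - \<beta>) + K * \<bar>w y / (1 + norm y powr \<beta>)\<bar>)"
      by (intro AE_I2) (metis abs_ge_self order_trans real_norm_def)
  qed measurable
qed

lemma C11_loc_quadratic_remainder:
  fixes w :: "real ^ 'n \<Rightarrow> real"
  assumes "C11_loc w"
  obtains \<gamma> r L where "r > 0"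
    and "\<And>y. y \<in> ball x r \<Longrightarrow> \<bar>w y - w x - (y - x) \<bullet> \<gamma>\<bar> \<le> L * (dist x y)\<^sup>2"
proof -
  obtain G where G: "\<And>x. GDERIV w x :> G x"
    and lip: "\<And>x. \<exists>r>0. \<exists>L. L-lipschitz_on (cball x r) G"
    using assms unfolding C11_loc_def by auto
  obtain r L where r: "r > 0" and L: "L-lipschitz_on (cball x r) G" using lip by blast
  have "\<bar>w y - w x - (y - x) \<bullet> G x\<bar> \<le> L * (dist x y)\<^sup>2" if y: "y \<in> ball x r" for y
  proof -
    have "norm (w y - w x - (\<lambda>h. h \<bullet> G x) (y - x)) \<le> norm (y - x) * (L * dist x y)"
    proof (rule differentiable_bound_linearization[where S = "cball x (dist x y)" and f' = "\<lambda>z h. h \<bullet> G z"])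
      show "x + t *\<^sub>R (y - x) \<in> cball x (dist x y)" if "t \<in> {0..1}" for t
        using that by (simp add: dist_norm norm_minus_commute mult_left_le_one_le)
      show "(w has_derivative (\<lambda>h. h \<bullet> G z)) (at z within cball x (dist x y))" for z
        using G[of z] unfolding gderiv_def by (rule has_derivative_at_withinI)
      show "onorm ((\<lambda>h. h \<bullet> G z) - (\<lambda>h. h \<bullet> G x)) \<le> L * dist x y" if z: "z \<in> cball x (dist x y)" for z
      proof (rule onorm_le)
        fix h :: "real ^ 'n"
        have "dist (G z) (G x) \<le> L * dist z x"
          using L by (rule lipschitz_onD) (use z y r in auto)
        also have "\<dots> \<le> L * dist x y"
          using z lipschitz_on_nonneg[OF L] by (intro mult_left_mono) (auto simp: dist_commute)
        finally have "norm (G z - G x) \<le> L * dist x y" by (simp add: dist_norm)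
        then have "norm h * norm (G z - G x) \<le> L * dist x y * norm h"
          by (metis mult.commute mult_left_mono norm_ge_zero)
        moreover have "\<bar>h \<bullet> (G z - G x)\<bar> \<le> norm h * norm (G z - G x)"
          by (rule Cauchy_Schwarz_ineq2)
        ultimately show "norm (((\<lambda>h. h \<bullet> G z) - (\<lambda>h. h \<bullet> G x)) h) \<le> L * dist x y * norm h"
          by (simp add: inner_diff_right)
      qed
    qed auto
    then show ?thesis by (simp add: dist_norm norm_minus_commute power2_eq_square mult_ac)
  qed
  with r that show thesis by blast
qed

lemma C11_loc_continuous:
  assumes "C11_loc w"
  shows "continuous_on UNIV w"
  using assms unfolding C11_loc_def gderiv_def
  by (meson has_derivative_continuous continuous_at_imp_continuous_on)

text \<open>
  Adding the linear term \<open>(y - x) \<bullet> \<gamma>\<close> on a ball around \<open>x\<close> does not change the truncated integrals, because it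
  is odd about \<open>x\<close>. Afterwards the integrand near \<open>x\<close> is bounded by a multiple of \<open>dist x y powr (2 - \<beta>)\<close>, which is
  integrable since \<open>\<beta> < DIM('a) + 2\<close>, and dominated convergence yields the limit.
\<close>

lemma pv_limit_exists:
  fixes w :: "'a::euclidean_space \<Rightarrow> real"
  assumes w [measurable]: "w \<in> borel_measurable borel"
    and outer: "\<And>\<epsilon>. \<epsilon> > 0 \<Longrightarrow> integrable lborel (pv_integrand \<beta> w x \<epsilon>)"
    and \<beta>: "real DIM('a) < \<beta>" "\<beta> < real DIM('a) + 2"
    and r: "r > 0"
    and taylor: "\<And>y. y \<in> ball x r \<Longrightarrow> \<bar>w y - w x - (y - x) \<bullet> \<gamma>\<bar> \<le> L * (dist x y)\<^sup>2"
  shows "\<exists>I. ((\<lambda>\<epsilon>. integral\<^sup>L lborel (pv_integrand \<beta> w x \<epsilon>)) \<longlongrightarrow> I) (at_right 0)"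
proof -
  have ball_meas [measurable]: "ball x \<epsilon> \<in> sets borel" for \<epsilon> by simp
  define c where "c y = indicator (ball x r) y * ((y - x) \<bullet> \<gamma>) / dist x y powr \<beta>" for y
  have [measurable]: "c \<in> borel_measurable borel"
    unfolding c_def by measurable
  define H where "H \<epsilon> y = indicator (- ball x \<epsilon>) y * ((w x - w y) / dist x y powr \<beta> + c y)" for \<epsilon> y
  define H0 where "H0 y = (w x - w y) / dist x y powr \<beta> + c y" for y
  have H_meas [measurable]: "H \<epsilon> \<in> borel_measurable borel" for \<epsilon>
    unfolding H_def by measurable
  have [measurable]: "H0 \<in> borel_measurable borel"
    unfolding H0_def by measurable
  have same_integral: "integral\<^sup>L lborel (H \<epsilon>) = integral\<^sup>L lborel (pv_integrand \<beta> w x \<epsilon>)" if \<epsilon>: "\<epsilon> > 0" for \<epsilon>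
  proof -
    define odd_part where "odd_part y = indicator (- ball x \<epsilon>) y * c y" for y
    have [measurable]: "odd_part \<in> borel_measurable borel" unfolding odd_part_def by measurable
    have "integrable lborel (\<lambda>y. r * norm \<gamma> * (indicator (- ball x \<epsilon>) y * dist x y powr - \<beta>))"
      using \<epsilon> \<beta> by (intro integrable_mult_right integrable_dist_powr_outside_ball)
    then have int: "integrable lborel odd_part"
    proof (rule Bochner_Integration.integrable_bound)
      have "norm (odd_part y) \<le> norm (r * norm \<gamma> * (indicator (- ball x \<epsilon>) y * dist x y powr - \<beta>))" for y
      proof (cases "\<epsilon> \<le> dist x y \<and> dist x y < r")
        case True
        have "\<bar>(y - x) \<bullet> \<gamma>\<bar> \<le> dist x y * norm \<gamma>"
          using Cauchy_Schwarz_ineq2[of "y - x" \<gamma>] by (simp add: dist_norm norm_minus_commute)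
        also have "\<dots> \<le> r * norm \<gamma>" using True by (intro mult_right_mono) auto
        finally have "\<bar>(y - x) \<bullet> \<gamma>\<bar> / dist x y powr \<beta> \<le> r * norm \<gamma> / dist x y powr \<beta>"
          by (rule divide_right_mono) simp
        then show ?thesis using True r by (simp add: odd_part_def c_def powr_minus divide_inverse abs_mult)
      next
        case False
        then have "odd_part y = 0" by (auto simp: odd_part_def c_def indicator_def)
        then show ?thesis by simp
      qed
      then show "AE y in lborel. norm (odd_part y) \<le> norm (r * norm \<gamma> * (indicator (- ball x \<epsilon>) y * dist x y powr - \<beta>))"
        by simp
    qed measurable
    have "integral\<^sup>L lborel odd_part = integral\<^sup>L (distr lborel borel (\<lambda>y. 2 *\<^sub>R x + - y)) odd_part"
      by (subst lborel_distr_rigid_motion) (auto simp: orthogonal_transformation_def linear_uminus)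
    also have "\<dots> = (\<integral>y. odd_part (2 *\<^sub>R x + - y) \<partial>lborel)"
      by (rule integral_distr) measurable
    also have "\<dots> = (\<integral>y. - odd_part y \<partial>lborel)"
    proof (intro Bochner_Integration.integral_cong refl)
      fix y
      have d: "dist x (2 *\<^sub>R x - y) = dist x y"
        by (simp add: dist_norm scaleR_2 norm_minus_commute)
      have "(2 *\<^sub>R x - y - x) \<bullet> \<gamma> = - ((y - x) \<bullet> \<gamma>)"
        by (simp add: scaleR_2 inner_diff_left inner_add_left)
      with d show "odd_part (2 *\<^sub>R x + - y) = - odd_part y"
        by (simp add: odd_part_def c_def indicator_def)
    qed
    finally have zero: "integral\<^sup>L lborel odd_part = 0" by simp
    have "H \<epsilon> = (\<lambda>y. pv_integrand \<beta> w x \<epsilon> y + odd_part y)"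
      by (simp add: fun_eq_iff H_def pv_integrand_def odd_part_def algebra_simps)
    then show ?thesis using outer[OF \<epsilon>] int zero by simp
  qed
  define B where "B y = L * (indicator (ball x r) y * dist x y powr - (\<beta> - 2)) + \<bar>pv_integrand \<beta> w x r y\<bar>" for y
  have B_int: "integrable lborel B"
    unfolding B_def using \<beta> r outer
    by (intro Bochner_Integration.integrable_add integrable_mult_right integrable_abs integrable_dist_powr_ball) auto
  have dom: "norm (H \<epsilon> y) \<le> B y" if "\<epsilon> > 0" for \<epsilon> y
  proof (cases "dist x y < r")
    case near: True
    show ?thesis
    proof (cases "\<epsilon> \<le> dist x y")
      case True
      then have pos: "dist x y > 0" using that by linarith
      have "H \<epsilon> y = - (w y - w x - (y - x) \<bullet> \<gamma>) / dist x y powr \<beta>"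
        using near True by (simp add: H_def c_def add_divide_distrib[symmetric])
      also have "norm \<dots> = \<bar>w y - w x - (y - x) \<bullet> \<gamma>\<bar> / dist x y powr \<beta>"
        unfolding norm_divide norm_minus_cancel by simp
      also have "\<dots> \<le> L * (dist x y)\<^sup>2 / dist x y powr \<beta>"
        using taylor near by (intro divide_right_mono) auto
      also have "\<dots> = L * dist x y powr - (\<beta> - 2)"
        using pos by (simp add: powr_diff powr_minus divide_simps)
      finally show ?thesis using near by (simp add: B_def)
    next
      case False
      have "0 \<le> L * (dist x y)\<^sup>2" using taylor[of y] near by (smt (verit) abs_ge_zero mem_ball)
      then have "0 \<le> L * dist x y powr - (\<beta> - 2)"
        by (cases "dist x y = 0") (auto simp: zero_le_mult_iff)
      with False show ?thesis using near by (simp add: B_def H_def)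
    qed
  next
    case False
    then show ?thesis by (simp add: B_def H_def c_def pv_integrand_def indicator_def)
  qed
  have "((\<lambda>\<epsilon>. integral\<^sup>L lborel (H \<epsilon>)) \<longlongrightarrow> integral\<^sup>L lborel H0) (at_right 0)"
  proof (rule tendsto_at_right_sequentially[of 0 1])
    fix S :: "nat \<Rightarrow> real" assume S: "\<And>n. 0 < S n" "S \<longlonglongrightarrow> 0"
    show "(\<lambda>n. integral\<^sup>L lborel (H (S n))) \<longlonglongrightarrow> integral\<^sup>L lborel H0"
    proof (rule integral_dominated_convergence[where w = B])
      have "(\<lambda>n. H (S n) y) \<longlonglongrightarrow> H0 y" for y
      proof (cases "y = x")
        case True
        then show ?thesis by (simp add: H_def H0_def c_def)
      next
        case False
        then have "eventually (\<lambda>n. S n < dist x y) sequentially"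
          using S(2) by (intro order_tendstoD(2)[OF S(2)]) auto
        then have "eventually (\<lambda>n. H (S n) y = H0 y) sequentially"
          by eventually_elim (simp add: H_def H0_def)
        then show ?thesis by (rule tendsto_eventually)
      qed
      then show "AE y in lborel. (\<lambda>n. H (S n) y) \<longlonglongrightarrow> H0 y" by simp
      show "AE y in lborel. norm (H (S n) y) \<le> B y" for n using dom S(1) by simp
    qed (use B_int in auto)
  qed simp
  then have "((\<lambda>\<epsilon>. integral\<^sup>L lborel (pv_integrand \<beta> w x \<epsilon>)) \<longlongrightarrow> integral\<^sup>L lborel H0) (at_right 0)"
    by (rule Lim_transform_eventually)
       (auto intro!: eventually_mono[OF eventually_at_right_less] simp: same_integral)
  then show ?thesis by blast
qed

section \<open>The fractional Laplacian at a negative minimum of the reflected difference\<close>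

lemma reflect_inner: "norm e = 1 \<Longrightarrow> reflect e l y \<bullet> e = 2 * l - y \<bullet> e"
  by (simp add: reflect_def inner_add_left dot_square_norm)

lemma reflect_reflect: "norm e = 1 \<Longrightarrow> reflect e l (reflect e l y) = y"
  unfolding reflect_def[of e l "reflect e l y"] by (simp add: reflect_inner, simp add: reflect_def scaleR_left.add[symmetric])

lemma reflect_eq_rigid_motion:
  "reflect e l y = (2 * l) *\<^sub>R e + (y - (2 * (y \<bullet> e)) *\<^sub>R e)"
  by (simp add: reflect_def algebra_simps)

lemma orthogonal_transformation_linear_reflection:
  fixes e :: "'a::real_inner"
  assumes "norm e = 1"
  shows "orthogonal_transformation (\<lambda>y. y - (2 * (y \<bullet> e)) *\<^sub>R e)"
  unfolding orthogonal_transformation_def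
proof (intro conjI allI)
  show "linear (\<lambda>y. y - (2 * (y \<bullet> e)) *\<^sub>R e)"
    by (rule linearI) (simp_all add: inner_add_left algebra_simps)
  show "(v - (2 * (v \<bullet> e)) *\<^sub>R e) \<bullet> (w - (2 * (w \<bullet> e)) *\<^sub>R e) = v \<bullet> w" for v w
    using assms by (simp add: inner_diff_left inner_diff_right dot_square_norm inner_commute[of e])
qed

lemma lborel_distr_reflect: "norm e = 1 \<Longrightarrow> distr lborel borel (reflect e l) = lborel"
  unfolding reflect_eq_rigid_motion[abs_def]
  by (rule lborel_distr_rigid_motion[OF orthogonal_transformation_linear_reflection])

lemma reflect_measurable [measurable]: "reflect e l \<in> borel_measurable borel"
  unfolding reflect_def[abs_def] by (intro borel_measurable_continuous_onI continuous_intros)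

lemma dist_reflect:
  assumes "norm e = 1"
  shows "dist (reflect e l x) (reflect e l y) = dist x y"
proof -
  have "reflect e l x - reflect e l y = (x - y) - (2 * ((x - y) \<bullet> e)) *\<^sub>R e"
    by (simp add: reflect_def algebra_simps inner_diff_left)
  then show ?thesis
    using orthogonal_transformation_norm[OF orthogonal_transformation_linear_reflection[OF assms], of "x - y"]
    by (simp add: dist_norm)
qed

text \<open>
  Squaring both sides, the difference is \<open>4 * (l - z \<bullet> e) * (l - x \<bullet> e)\<close>, a product of two nonnegative
  numbers for points on the same side of the mirror.
\<close>

lemma dist_le_dist_reflect:
  assumes e: "norm e = 1" and "x \<bullet> e \<le> l" "z \<bullet> e \<le> l"
  shows "dist x z \<le> dist x (reflect e l z)"
proof -
  have ee: "e \<bullet> e = 1" using e by (simp add: dot_square_norm)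
  have expand: "(norm (p - k *\<^sub>R e))\<^sup>2 = (norm p)\<^sup>2 - 2 * k * (p \<bullet> e) + k\<^sup>2" for p k
    by (simp only: power2_norm_eq_inner)
       (simp add: inner_diff_left inner_diff_right inner_commute[of e p] ee power2_eq_square algebra_simps)
  have "x - reflect e l z = (x - z) - (2 * (l - z \<bullet> e)) *\<^sub>R e"
    by (simp add: reflect_def)
  then have "(norm (x - reflect e l z))\<^sup>2 = (norm (x - z))\<^sup>2 + 4 * ((l - z \<bullet> e) * (l - x \<bullet> e))"
    by (simp only: expand inner_diff_left) (simp add: power2_eq_square algebra_simps)
  moreover have "0 \<le> (l - z \<bullet> e) * (l - x \<bullet> e)" using assms by simp
  ultimately have "(norm (x - z))\<^sup>2 \<le> (norm (x - reflect e l z))\<^sup>2" by linarith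
  then show ?thesis by (simp add: dist_norm power2_le_iff_abs_le)
qed

text \<open>
  The difference of the two truncated integrals is the integral of \<open>(U x - U y) / dist x y powr \<beta>\<close> over the
  complement of a small ball, where \<open>U = refl_diff e l w\<close>. Since \<open>U\<close> is odd under the reflection, the part beyond
  the mirror folds back to the half-space, where it becomes \<open>(U x + U y) / D powr \<beta>\<close> with \<open>D\<close> the distance of
  \<open>x\<close> to the mirror image of \<open>y\<close>. As \<open>U x \<le> U y\<close> and \<open>dist x y \<le> D\<close>, both parts together are at most
  \<open>2 * U x / D powr \<beta>\<close>. In the excised ball only the folded part survives; the radius is chosen such that \<open>U\<close>
  is still negative there, which gives \<open>U x / D powr \<beta>\<close>. This weaker bound serves for all \<open>y\<close> and is kept only on
  the largest ball around \<open>x\<close> inside the half-space, on which \<open>D\<close> is at most three times the radius.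
\<close>

lemma pv_reflected_difference_le:
  fixes w :: "real ^ 'n \<Rightarrow> real"
  assumes e: "norm e = 1" and x: "x \<bullet> e < l"
    and cont: "continuous_on UNIV w"
    and int: "\<And>x \<epsilon>. \<epsilon> > 0 \<Longrightarrow> integrable lborel (pv_integrand \<beta> w x \<epsilon>)"
    and \<beta>: "\<beta> > 0"
    and min: "\<And>z. z \<bullet> e \<le> l \<Longrightarrow> refl_diff e l w x \<le> refl_diff e l w z"
    and neg: "refl_diff e l w x < 0"
  shows "\<forall>\<^sub>F \<epsilon> in at_right 0.
    integral\<^sup>L lborel (pv_integrand \<beta> w (reflect e l x) \<epsilon>) - integral\<^sup>L lborel (pv_integrand \<beta> w x \<epsilon>)
      \<le> measure lborel (ball x (l - x \<bullet> e)) * (refl_diff e l w x / (3 * (l - x \<bullet> e)) powr \<beta>)"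
proof -
  let ?R = "reflect e l"
  let ?W = "refl_diff e l w"
  define d where "d = l - x \<bullet> e"
  have d: "d > 0" using x by (simp add: d_def)
  have [measurable]: "w \<in> borel_measurable borel"
    by (rule borel_measurable_continuous_onI[OF cont])
  have ball_meas [measurable]: "ball x \<epsilon> \<in> sets borel" for x :: "real ^ 'n" and \<epsilon> by simp
  have [measurable]: "?W \<in> borel_measurable borel"
    unfolding refl_diff_def by measurable
  have W_cont: "continuous_on UNIV ?W"
    unfolding refl_diff_def reflect_def
    by (intro continuous_intros continuous_on_compose2[OF cont]) auto
  have W_R: "?W (?R y) = - ?W y" for y by (simp add: refl_diff_def reflect_reflect[OF e])
  have "\<forall>\<^sub>F y in at x. ?W y < 0"
    using W_cont neg by (intro order_tendstoD(2)[of _ "?W x"]) (auto simp: continuous_on_def)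
  then obtain \<eta> where \<eta>: "\<eta> > 0" and near_neg: "\<And>y. dist y x < \<eta> \<Longrightarrow> ?W y < 0"
  proof -
    obtain \<eta> where "\<eta> > 0" "\<And>y. y \<noteq> x \<Longrightarrow> dist y x < \<eta> \<Longrightarrow> ?W y < 0"
      using \<open>\<forall>\<^sub>F y in at x. ?W y < 0\<close> unfolding eventually_at by auto
    then have "?W y < 0" if "dist y x < \<eta>" for y using neg that by (cases "y = x") auto
    with \<open>\<eta> > 0\<close> show thesis by (rule that)
  qed
  have "integral\<^sup>L lborel (pv_integrand \<beta> w (?R x) \<epsilon>) - integral\<^sup>L lborel (pv_integrand \<beta> w x \<epsilon>)
      \<le> measure lborel (ball x d) * (?W x / (3 * d) powr \<beta>)" if \<epsilon>: "0 < \<epsilon>" "\<epsilon> < \<eta>" "\<epsilon> < d" for \<epsilon>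
  proof -
    define F where "F y = indicator (- ball x \<epsilon>) y * ((?W x - ?W y) / dist x y powr \<beta>)" for y
    have [measurable]: "F \<in> borel_measurable borel" unfolding F_def by measurable
    let ?S = "{y. y \<bullet> e < l}" and ?T = "{y. l < y \<bullet> e}"
    have half_sets: "?S \<in> sets borel" "?T \<in> sets borel"
      by (auto intro!: borel_open open_Collect_less continuous_intros)
    have transport: "integrable lborel (\<lambda>y. h (?R y))" "(\<integral>y. h (?R y) \<partial>lborel) = integral\<^sup>L lborel h"
      if h: "integrable lborel h" for h :: "real ^ 'n \<Rightarrow> real"
    proof -
      have m: "h \<in> borel_measurable borel" using borel_measurable_integrable[OF h] by simp
      show "integrable lborel (\<lambda>y. h (?R y))"
        using integrable_distr[of ?R lborel borel h] h by (simp add: lborel_distr_reflect[OF e])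
      show "(\<integral>y. h (?R y) \<partial>lborel) = integral\<^sup>L lborel h"
        using integral_distr[of ?R lborel borel h] m by (simp add: lborel_distr_reflect[OF e])
    qed
    have F_eq: "F y = pv_integrand \<beta> w (?R x) \<epsilon> (?R y) - pv_integrand \<beta> w x \<epsilon> y" for y
      by (simp add: F_def pv_integrand_def refl_diff_def dist_reflect[OF e] indicator_def diff_divide_distrib)
    have int_F: "integrable lborel F"
      unfolding F_eq using int \<epsilon> by (intro Bochner_Integration.integrable_diff transport) auto
    have restrict: "integrable lborel (\<lambda>y. indicator A y * h y)"
      if "A \<in> sets borel" "integrable lborel h" for A and h :: "real ^ 'n \<Rightarrow> real"
      using integrable_mult_indicator[OF _ that(2), of A] that(1) by simp
    have "integral\<^sup>L lborel (pv_integrand \<beta> w (?R x) \<epsilon>) - integral\<^sup>L lborel (pv_integrand \<beta> w x \<epsilon>)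
        = integral\<^sup>L lborel F"
      unfolding F_eq using int \<epsilon> transport by (simp add: Bochner_Integration.integral_diff)
    also have "\<dots> \<le> (\<integral>y. indicator ?S y * F y + indicator ?T y * F y \<partial>lborel)"
    proof (rule integral_mono)
      show "integrable lborel (\<lambda>y. indicator ?S y * F y + indicator ?T y * F y)"
        by (intro Bochner_Integration.integrable_add restrict half_sets int_F)
      fix y
      show "F y \<le> indicator ?S y * F y + indicator ?T y * F y"
      \<comment> \<open>On the mirror itself \<open>U\<close> vanishes, so the integrand is nonpositive there and may be dropped from the upper bound.\<close>
      proof (cases "y \<bullet> e = l")
        case True
        then have "?R y = y" by (simp add: reflect_def)
        then have "?W y = 0" by (simp add: refl_diff_def)
        then have "F y \<le> 0"
          using neg by (simp add: F_def indicator_def divide_nonpos_nonneg)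
        with True show ?thesis by simp
      qed (auto simp: indicator_def)
    qed (rule int_F)
    also have "\<dots> = (\<integral>y. indicator ?S y * (F y + F (?R y)) \<partial>lborel)"
    proof -
      have S: "integrable lborel (\<lambda>y. indicator ?S y * F y)" and T: "integrable lborel (\<lambda>y. indicator ?T y * F y)"
        by (intro restrict half_sets int_F)+
      have swap: "indicator ?T (?R y) = (indicator ?S y :: real)" for y
        by (simp add: indicator_def reflect_inner[OF e])
      show ?thesis
        using S T transport[OF T] by (simp add: swap distrib_left)
    qed
    also have "\<dots> \<le> (\<integral>y. indicator (ball x d) y * (?W x / (3 * d) powr \<beta>) \<partial>lborel)"
    proof (rule integral_mono)
      show "integrable lborel (\<lambda>y. indicator ?S y * (F y + F (?R y)))"
        by (intro restrict half_sets Bochner_Integration.integrable_add int_F transport(1))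
      show "integrable lborel (\<lambda>y. indicator (ball x d) y * (?W x / (3 * d) powr \<beta>))"
        by (intro integrable_mult_left integrable_real_indicator) (use d in \<open>auto simp: emeasure_ball\<close>)
      fix y
      show "indicator ?S y * (F y + F (?R y)) \<le> indicator (ball x d) y * (?W x / (3 * d) powr \<beta>)"
      proof (cases "y \<in> ?S")
        case False
        have "y \<notin> ball x d"
        proof
          assume "y \<in> ball x d"
          moreover have "(y - x) \<bullet> e \<le> norm (y - x)"
            using norm_cauchy_schwarz[of "y - x" e] e by simp
          ultimately have "(y - x) \<bullet> e < d" by (simp add: dist_norm norm_minus_commute)
          with False show False by (simp add: d_def inner_diff_left)
        qed
        with False show ?thesis by simp
      next
        case True
        define D where "D = dist x (?R y)"
        have "(?R y - x) \<bullet> e \<le> norm (?R y - x)"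
          using norm_cauchy_schwarz[of "?R y - x" e] e by simp
        then have dD: "d < D"
          using True by (simp add: D_def d_def inner_diff_left reflect_inner[OF e] dist_norm norm_minus_commute)
        have FR: "F (?R y) = (?W x + ?W y) / D powr \<beta>"
          using dD \<epsilon> by (simp add: F_def W_R D_def indicator_def)
        have Dpos: "D powr \<beta> > 0" using dD d by simp
        have W_min: "?W x \<le> ?W y" using True by (intro min) simp
        have sum: "F y + F (?R y) \<le> ?W x / D powr \<beta>"
        proof (cases "dist x y < \<epsilon>")
          case True
          then have "?W y < 0" using near_neg \<epsilon> by (simp add: dist_commute)
          then have "(?W x + ?W y) / D powr \<beta> \<le> ?W x / D powr \<beta>"
            by (intro divide_right_mono) auto
          with True FR show ?thesis by (simp add: F_def)
        next
          case False
          then have pos: "dist x y > 0" using \<epsilon> by linarith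
          have "dist x y \<le> D"
            unfolding D_def using x True e by (intro dist_le_dist_reflect) auto
          then have "dist x y powr \<beta> \<le> D powr \<beta>" using pos \<beta> by (intro powr_mono2) auto
          then have "(?W y - ?W x) / D powr \<beta> \<le> (?W y - ?W x) / dist x y powr \<beta>"
            using pos W_min Dpos by (intro divide_left_mono mult_pos_pos) auto
          moreover have "F y = - ((?W y - ?W x) / dist x y powr \<beta>)"
            using False by (simp add: F_def divide_minus_left[symmetric] del: divide_minus_left)
          ultimately have "F y + F (?R y) \<le> - ((?W y - ?W x) / D powr \<beta>) + (?W x + ?W y) / D powr \<beta>"
            using FR by linarith
          also have "\<dots> = 2 * ?W x / D powr \<beta>"
            by (simp add: divide_minus_left[symmetric] add_divide_distrib[symmetric] del: divide_minus_left)
          also have "\<dots> \<le> ?W x / D powr \<beta>" using neg by (intro divide_right_mono) auto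
          finally show ?thesis .
        qed
        show ?thesis
        proof (cases "y \<in> ball x d")
          case inside: True
          have "dist x (?R x) = 2 * d"
            using x e by (simp add: dist_norm reflect_def d_def)
          moreover have "D \<le> dist x (?R x) + dist (?R x) (?R y)"
            unfolding D_def by (rule dist_triangle)
          ultimately have "D \<le> 3 * d" using inside by (simp add: dist_reflect[OF e])
          then have "D powr \<beta> \<le> (3 * d) powr \<beta>" using dD d \<beta> by (intro powr_mono2) auto
          then have "?W x / D powr \<beta> \<le> ?W x / (3 * d) powr \<beta>"
            using neg Dpos d by (intro divide_left_mono_neg) auto
          with sum True inside show ?thesis by simp
        next
          case False
          have "?W x / D powr \<beta> \<le> 0" using neg by (simp add: divide_nonpos_nonneg)
          with sum True False show ?thesis by simp
        qed
      qed
    qed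
    also have "\<dots> = measure lborel (ball x d) * (?W x / (3 * d) powr \<beta>)"
      by simp
    finally show ?thesis .
  qed
  moreover have "\<forall>\<^sub>F \<epsilon> in at_right (0::real). 0 < \<epsilon> \<and> \<epsilon> < \<eta> \<and> \<epsilon> < d"
    using \<eta> d by (intro eventually_conj eventually_at_right_less order_tendstoD(2)[OF tendsto_ident_at])
  ultimately show ?thesis unfolding d_def[symmetric] by (auto elim: eventually_mono)
qed

text \<open>
  The previous bound survives the limit of the truncation radius. Its right-hand side scales like the volume of a
  ball of radius \<open>l - x \<bullet> e\<close> divided by the power \<open>CARD('n) + \<alpha>\<close> of that radius.
\<close>

lemma frac_laplacian_reflected_difference_le:
  fixes w :: "real ^ 'n \<Rightarrow> real"
  assumes C: "C > 0" and \<alpha>: "0 < \<alpha>" "\<alpha> < 2"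
    and e: "norm e = 1" and x: "x \<bullet> e < l"
    and w: "w \<in> L_space \<alpha>" "C11_loc w"
    and min: "\<And>z. z \<bullet> e \<le> l \<Longrightarrow> refl_diff e l w x \<le> refl_diff e l w z"
    and neg: "refl_diff e l w x < 0"
  shows "frac_laplacian C \<alpha> w (reflect e l x) - frac_laplacian C \<alpha> w x
    \<le> C * unit_ball_vol (real CARD('n)) * 3 powr - (real CARD('n) + \<alpha>)
        * (l - x \<bullet> e) powr - \<alpha> * refl_diff e l w x"
proof -
  define \<beta> where "\<beta> = real CARD('n) + \<alpha>"
  have \<beta>: "\<beta> > 0" "\<beta> > real DIM(real ^ 'n)" "\<beta> < real DIM(real ^ 'n) + 2"
    using \<alpha> by (auto simp: \<beta>_def intro: add_nonneg_pos)
  have cont: "continuous_on UNIV w" by (rule C11_loc_continuous[OF w(2)])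
  then have meas: "w \<in> borel_measurable borel" by (rule borel_measurable_continuous_onI)
  have int: "integrable lborel (pv_integrand \<beta> w z \<epsilon>)" if "\<epsilon> > 0" for z \<epsilon>
    using pv_integrand_integrable[OF meas _ \<beta>(2) that] L_space_weighted_integrable[OF w(1) meas]
    by (simp add: \<beta>_def)
  have "\<exists>I. ((\<lambda>\<epsilon>. integral\<^sup>L lborel (pv_integrand \<beta> w z \<epsilon>)) \<longlongrightarrow> I) (at_right 0)" for z
  proof (rule C11_loc_quadratic_remainder[OF w(2), of z])
    fix \<gamma> r L
    assume r: "r > 0" and taylor: "\<And>y. y \<in> ball z r \<Longrightarrow> \<bar>w y - w z - (y - z) \<bullet> \<gamma>\<bar> \<le> L * (dist z y)\<^sup>2"
    show ?thesis by (rule pv_limit_exists[OF meas]) (rule int \<beta> r taylor | assumption)+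
  qed
  then have "\<exists>I. \<forall>z. ((\<lambda>\<epsilon>. integral\<^sup>L lborel (pv_integrand \<beta> w z \<epsilon>)) \<longlongrightarrow> I z) (at_right 0)"
    by (intro choice allI)
  then obtain I where I: "\<And>z. ((\<lambda>\<epsilon>. integral\<^sup>L lborel (pv_integrand \<beta> w z \<epsilon>)) \<longlongrightarrow> I z) (at_right 0)"
    by auto
  have lap: "frac_laplacian C \<alpha> w z = C * I z" for z
    using I[of z] unfolding \<beta>_def by (rule frac_laplacian_eq_pv_limit[OF meas])
  define d where "d = l - x \<bullet> e"
  have d: "d > 0" using x by (simp add: d_def)
  have "I (reflect e l x) - I x \<le> measure lborel (ball x d) * (refl_diff e l w x / (3 * d) powr \<beta>)"
    using pv_reflected_difference_le[OF e x cont int \<beta>(1) min neg]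
    by (intro tendsto_upperbound[OF tendsto_diff[OF I I]]) (auto simp: d_def trivial_limit_at_right_real)
  also have "measure lborel (ball x d) = unit_ball_vol (real CARD('n)) * d powr real CARD('n)"
    using d by (simp add: content_ball powr_realpow)
  also have "unit_ball_vol (real CARD('n)) * d powr real CARD('n) * (refl_diff e l w x / (3 * d) powr \<beta>)
      = unit_ball_vol (real CARD('n)) * 3 powr - \<beta> * d powr - \<alpha> * refl_diff e l w x"
    using d by (simp only: powr_minus_divide \<beta>_def powr_add powr_mult) (simp add: field_simps)
  finally have "C * (I (reflect e l x) - I x)
      \<le> C * (unit_ball_vol (real CARD('n)) * 3 powr - \<beta> * d powr - \<alpha> * refl_diff e l w x)"
    using C by (intro mult_left_mono) auto
  then show ?thesis by (simp add: lap d_def \<beta>_def algebra_simps)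
qed

section \<open>The reaction terms\<close>

lemma C1_on_quadrant_partials:
  assumes f: "C1_on ({0..} \<times> {0..}) (\<lambda>(s, t). f s t)" and st: "s > 0" "t > 0"
  shows "((\<lambda>s. f s t) has_real_derivative partial1 f s t) (at s)"
    and "((\<lambda>t. f s t) has_real_derivative partial2 f s t) (at t)"
proof -
  let ?Q = "{0..} \<times> {0..} :: (real \<times> real) set"
  obtain f' where f': "\<And>x. x \<in> ?Q \<Longrightarrow> ((\<lambda>(s, t). f s t) has_derivative blinfun_apply (f' x)) (at x within ?Q)"
    using f unfolding C1_on_def by blast
  have "(s, t) \<in> interior ?Q"
    using st by (simp add: interior_Times interior_real_atLeast)
  then have at: "at (s, t) within ?Q = at (s, t)" by (rule at_within_interior)
  have "(s, t) \<in> ?Q" using st by simp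
  from f'[OF this] have D: "((\<lambda>(s, t). f s t) has_derivative blinfun_apply (f' (s, t))) (at (s, t))"
    unfolding at .
  have "((\<lambda>s. f s t) has_derivative (\<lambda>h. f' (s, t) (h, 0))) (at s)"
    by (rule has_derivative_compose[where f = "\<lambda>s. (s, t)" and g = "\<lambda>(s, t). f s t", OF _ D, simplified case_prod_conv])
       (auto intro!: derivative_eq_intros)
  then have "(\<lambda>s. f s t) differentiable at s" by (rule differentiableI)
  then show "((\<lambda>s. f s t) has_real_derivative partial1 f s t) (at s)"
    unfolding partial1_def by (simp only: DERIV_deriv_iff_real_differentiable)
  have "((\<lambda>t. f s t) has_derivative (\<lambda>h. f' (s, t) (0, h))) (at t)"
    by (rule has_derivative_compose[where f = "\<lambda>t. (s, t)" and g = "\<lambda>(s, t). f s t", OF _ D, simplified case_prod_conv])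
       (auto intro!: derivative_eq_intros)
  then have "(\<lambda>t. f s t) differentiable at t" by (rule differentiableI)
  then show "((\<lambda>t. f s t) has_real_derivative partial2 f s t) (at t)"
    unfolding partial2_def by (simp only: DERIV_deriv_iff_real_differentiable)
qed

text \<open>
  The path from \<open>(s, t)\<close> to \<open>(s', t')\<close> goes through \<open>(s', t)\<close>. Along the first leg the mean value theorem
  gives the first product, evaluated at the larger endpoint \<open>s\<close> because \<open>p \<ge> 1\<close>. Along the second leg \<open>f\<close>
  does not decrease if \<open>t' \<ge> t\<close>; if \<open>t' < t\<close>, the loss is at most the second product times \<open>t - t'\<close>, which is
  at most twice \<open>s - s'\<close>. Only points below \<open>s\<close> and \<open>t\<close> enter the growth bounds, so smallness of \<open>s + t\<close> suffices.
\<close>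

lemma reaction_difference_lower_bound:
  fixes f :: "real \<Rightarrow> real \<Rightarrow> real"
  assumes D1: "\<And>s t. s > 0 \<Longrightarrow> t > 0 \<Longrightarrow> ((\<lambda>s. f s t) has_real_derivative partial1 f s t) (at s)"
    and D2: "\<And>s t. s > 0 \<Longrightarrow> t > 0 \<Longrightarrow> ((\<lambda>t. f s t) has_real_derivative partial2 f s t) (at t)"
    and growth1: "\<And>s t. s > 0 \<Longrightarrow> t > 0 \<Longrightarrow> s + t < \<delta> \<Longrightarrow> partial1 f s t \<le> s powr (p - 1) * t powr q"
    and growth2: "\<And>s t. s > 0 \<Longrightarrow> t > 0 \<Longrightarrow> s + t < \<delta> \<Longrightarrow> partial2 f s t \<le> s powr p * t powr (q - 1)"
    and mono2: "\<And>s t. s > 0 \<Longrightarrow> t > 0 \<Longrightarrow> partial2 f s t > 0"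
    and pq: "p \<ge> 1" "q \<ge> 1"
    and small: "s + t < \<delta>" and pos: "s' > 0" "t > 0" "t' > 0"
    and less: "s' < s" and partner: "t' - t \<ge> 2 * (s' - s)"
  shows "f s' t' - f s t \<ge> (s powr (p - 1) * t powr q + 2 * (s powr p * t powr (q - 1))) * (s' - s)"
proof -
  have "\<exists>z>s'. z < s \<and> f s t - f s' t = (s - s') * partial1 f z t"
    using less pos by (intro MVT2) (auto intro!: D1)
  then obtain z where z: "s' < z" "z < s" "f s t - f s' t = (s - s') * partial1 f z t" by blast
  have "partial1 f z t \<le> z powr (p - 1) * t powr q"
    using z pos small by (intro growth1) auto
  also have "\<dots> \<le> s powr (p - 1) * t powr q"
    using z pos pq by (intro mult_right_mono powr_mono2) auto
  finally have "(s - s') * partial1 f z t \<le> (s - s') * (s powr (p - 1) * t powr q)"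
    using less by (intro mult_left_mono) auto
  with z have first: "f s' t - f s t \<ge> s powr (p - 1) * t powr q * (s' - s)"
    by (simp add: algebra_simps)
  have second: "f s' t' - f s' t \<ge> 2 * (s powr p * t powr (q - 1)) * (s' - s)"
  proof (cases "t' < t")
    case True
    have "\<exists>z>t'. z < t \<and> f s' t - f s' t' = (t - t') * partial2 f s' z"
      using True pos by (intro MVT2) (auto intro!: D2)
    then obtain z where z: "t' < z" "z < t" "f s' t - f s' t' = (t - t') * partial2 f s' z" by blast
    have "partial2 f s' z \<le> s' powr p * z powr (q - 1)"
      using z pos small less by (intro growth2) auto
    also have "\<dots> \<le> s powr p * t powr (q - 1)"
      using z pos pq less by (intro mult_mono powr_mono2) auto
    finally have "(t - t') * partial2 f s' z \<le> (t - t') * (s powr p * t powr (q - 1))"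
      using True by (intro mult_left_mono) auto
    also have "\<dots> \<le> 2 * (s - s') * (s powr p * t powr (q - 1))"
      using partner by (intro mult_right_mono) auto
    finally show ?thesis using z by (simp add: algebra_simps)
  next
    case False
    have "f s' t \<le> f s' t'"
      using False pos by (intro DERIV_nonneg_imp_nondecreasing[of t t' "f s'"])
        (auto intro!: exI[of _ "partial2 f s' _"] D2 less_imp_le[OF mono2])
    moreover have "2 * (s powr p * t powr (q - 1)) * (s' - s) \<le> 0"
      using less by (intro mult_nonneg_nonpos) auto
    ultimately show ?thesis by linarith
  qed
  from first second show ?thesis by (simp add: algebra_simps)
qed

lemma eventually_powr_sum_less_powr:
  fixes \<kappa> :: real
  assumes "\<kappa> > 0" "\<alpha> < \<mu>" "\<alpha> < \<nu>"
  shows "\<forall>\<^sub>F \<rho> in at_top. \<rho> powr - \<mu> + 2 * \<rho> powr - \<nu> < \<kappa> * \<rho> powr - \<alpha>"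
proof -
  have "((\<lambda>\<rho>. \<rho> powr (\<alpha> - \<mu>) + 2 * \<rho> powr (\<alpha> - \<nu>)) \<longlongrightarrow> 0 + 2 * 0) at_top"
    using assms by (intro tendsto_add tendsto_mult tendsto_const tendsto_neg_powr filterlim_ident) auto
  then have "\<forall>\<^sub>F \<rho> in at_top. \<rho> powr (\<alpha> - \<mu>) + 2 * \<rho> powr (\<alpha> - \<nu>) < \<kappa>"
    using assms by (intro order_tendstoD(2)) auto
  then show ?thesis
    using eventually_gt_at_top[of 0]
  proof eventually_elim
    case (elim \<rho>)
    have "\<rho> powr - \<mu> + 2 * \<rho> powr - \<nu> = (\<rho> powr (\<alpha> - \<mu>) + 2 * \<rho> powr (\<alpha> - \<nu>)) * \<rho> powr - \<alpha>"
      by (simp add: distrib_right powr_add[symmetric])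
    also have "\<dots> < \<kappa> * \<rho> powr - \<alpha>"
      using elim by (intro mult_strict_right_mono) auto
    finally show ?case .
  qed
qed

section \<open>Comparison of the two bounds\<close>

text \<open>
  This is one half of the theorem. Its hypotheses are stated for the equation of one component, so that it applies
  again with the roles of \<open>u\<close> and \<open>v\<close> exchanged. The radius is fixed before \<open>l\<close> and \<open>x\<close>; this is possible because the distance of \<open>x\<close> to
  the mirror enters only through the bound \<open>l - x \<bullet> e \<le> norm x\<close>, valid for all \<open>l \<le> 0\<close>.
\<close>

lemma decay_forces_partner_below:
  fixes C \<alpha> a b p q :: real
    and f :: "real \<Rightarrow> real \<Rightarrow> real"
    and u v :: "real ^ 'n \<Rightarrow> real"
    and e :: "real ^ 'n"
  assumes C: "C > 0"
    and alpha: "0 < \<alpha>" "\<alpha> < 2"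
    and e: "norm e = 1"
    and D1: "\<And>s t. s > 0 \<Longrightarrow> t > 0 \<Longrightarrow> ((\<lambda>s. f s t) has_real_derivative partial1 f s t) (at s)"
    and D2: "\<And>s t. s > 0 \<Longrightarrow> t > 0 \<Longrightarrow> ((\<lambda>t. f s t) has_real_derivative partial2 f s t) (at t)"
    and u: "u \<in> L_space \<alpha>" "C11_loc u"
    and eq_u: "\<And>x. frac_laplacian C \<alpha> u x = f (u x) (v x)"
    and pos: "\<And>x. u x > 0" "\<And>x. v x > 0"
    and ab: "a > 0" "b > 0"
    and pq: "p \<ge> 1" "q \<ge> 1"
    and decay: "lesssim_infinity u (\<lambda>x. norm x powr (- a))"
               "lesssim_infinity v (\<lambda>x. norm x powr (- b))"
    and growth1: "lesssim_origin (partial1 f) (\<lambda>s t. s powr (p - 1) * t powr q)"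
    and growth2: "lesssim_origin (partial2 f) (\<lambda>s t. s powr p * t powr (q - 1))"
    and mono2: "\<And>s t. s > 0 \<Longrightarrow> t > 0 \<Longrightarrow> partial2 f s t > 0"
    and exponents: "\<alpha> < a * p + b * q - a" "\<alpha> < a * p + b * q - b"
  shows "\<exists>R0>0. \<forall>l\<le>0. \<forall>x \<in> halfspace e l. norm x > R0 \<and>
      (\<forall>z \<in> closure (halfspace e l). refl_diff e l u x \<le> refl_diff e l u z) \<and>
      refl_diff e l u x < 0 \<longrightarrow> refl_diff e l v x < 2 * refl_diff e l u x"
proof -
  define \<kappa> where "\<kappa> = C * unit_ball_vol (real CARD('n)) * 3 powr - (real CARD('n) + \<alpha>)"
  \<comment> \<open>The products of powers of \<open>u x\<close> and \<open>v x\<close> from the partial derivatives decay at least with these exponents.\<close>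
  define \<mu> where "\<mu> = a * p + b * q - a"
  define \<nu> where "\<nu> = a * p + b * q - b"
  have \<kappa>: "\<kappa> > 0" using C by (simp add: \<kappa>_def)
  obtain R1 where R1: "\<And>x. norm x > R1 \<Longrightarrow> u x \<le> norm x powr - a"
    using decay(1) unfolding lesssim_infinity_def by blast
  obtain R2 where R2: "\<And>x. norm x > R2 \<Longrightarrow> v x \<le> norm x powr - b"
    using decay(2) unfolding lesssim_infinity_def by blast
  obtain \<delta>1 where \<delta>1: "\<delta>1 > 0"
    "\<And>s t. s > 0 \<Longrightarrow> t > 0 \<Longrightarrow> s + t < \<delta>1 \<Longrightarrow> partial1 f s t \<le> s powr (p - 1) * t powr q"
    using growth1 unfolding lesssim_origin_def by blast
  obtain \<delta>2 where \<delta>2: "\<delta>2 > 0"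
    "\<And>s t. s > 0 \<Longrightarrow> t > 0 \<Longrightarrow> s + t < \<delta>2 \<Longrightarrow> partial2 f s t \<le> s powr p * t powr (q - 1)"
    using growth2 unfolding lesssim_origin_def by blast
  define \<delta> where "\<delta> = min \<delta>1 \<delta>2"
  have "((\<lambda>\<rho>. \<rho> powr - a + \<rho> powr - b) \<longlongrightarrow> 0 + 0) at_top"
    using ab by (intro tendsto_add tendsto_neg_powr filterlim_ident) auto
  then have "\<forall>\<^sub>F \<rho> in at_top. \<rho> powr - a + \<rho> powr - b < \<delta>"
    using \<delta>1 \<delta>2 by (intro order_tendstoD(2)) (auto simp: \<delta>_def)
  moreover have "\<forall>\<^sub>F \<rho> in at_top. \<rho> powr - \<mu> + 2 * \<rho> powr - \<nu> < \<kappa> * \<rho> powr - \<alpha>"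
    using \<kappa> exponents by (intro eventually_powr_sum_less_powr) (auto simp: \<mu>_def \<nu>_def)
  ultimately have "\<forall>\<^sub>F \<rho> in at_top. \<rho> > R1 \<and> \<rho> > R2 \<and> \<rho> powr - a + \<rho> powr - b < \<delta>
      \<and> \<rho> powr - \<mu> + 2 * \<rho> powr - \<nu> < \<kappa> * \<rho> powr - \<alpha>"
    by (intro eventually_conj eventually_gt_at_top)
  then obtain R where R: "\<And>\<rho>. \<rho> \<ge> R \<Longrightarrow> \<rho> > R1 \<and> \<rho> > R2 \<and> \<rho> powr - a + \<rho> powr - b < \<delta>
      \<and> \<rho> powr - \<mu> + 2 * \<rho> powr - \<nu> < \<kappa> * \<rho> powr - \<alpha>"
    unfolding eventually_at_top_linorder by blast
  show ?thesis
  proof (intro exI[of _ "max R 1"] conjI allI ballI impI)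
    fix l :: real and x :: "real ^ 'n"
    assume l: "l \<le> 0" and x: "x \<in> halfspace e l"
      and "norm x > max R 1 \<and>
        (\<forall>z \<in> closure (halfspace e l). refl_diff e l u x \<le> refl_diff e l u z) \<and>
        refl_diff e l u x < 0"
    then have far: "norm x > max R 1"
      and min: "\<forall>z \<in> closure (halfspace e l). refl_diff e l u x \<le> refl_diff e l u z"
      and neg: "refl_diff e l u x < 0" by auto
    let ?U = "refl_diff e l u x" and ?V = "refl_diff e l v x"
    let ?x' = "reflect e l x"
    define \<rho> where "\<rho> = norm x"
    have \<rho>: "\<rho> > 0" "\<rho> \<ge> R" using far by (auto simp: \<rho>_def)
    have u_decay: "u x \<le> \<rho> powr - a" and v_decay: "v x \<le> \<rho> powr - b"
      using R[OF \<rho>(2)] R1 R2 by (auto simp: \<rho>_def)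
    have xl: "x \<bullet> e < l" using x by (simp add: halfspace_def)
    have "halfspace e l = {y. e \<bullet> y < l}" by (simp add: halfspace_def inner_commute)
    then have closed: "closure (halfspace e l) = {y. e \<bullet> y \<le> l}"
      using e by (metis closure_halfspace_lt norm_zero zero_neq_one)
    show "?V < 2 * ?U"
    proof (rule ccontr)
      assume "\<not> ?V < 2 * ?U"
      then have partner: "v ?x' - v x \<ge> 2 * (u ?x' - u x)" by (simp add: refl_diff_def)
      have "(u x powr (p - 1) * v x powr q + 2 * (u x powr p * v x powr (q - 1))) * (u ?x' - u x)
          \<le> f (u ?x') (v ?x') - f (u x) (v x)"
      proof (rule reaction_difference_lower_bound[OF D1 D2])
        show "u x + v x < \<delta>" using u_decay v_decay R[OF \<rho>(2)] by linarith
      qed (use \<delta>1 \<delta>2 mono2 pq pos neg partner in \<open>auto simp: refl_diff_def \<delta>_def\<close>)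
      moreover have "(\<rho> powr - \<mu> + 2 * \<rho> powr - \<nu>) * ?U
          \<le> (u x powr (p - 1) * v x powr q + 2 * (u x powr p * v x powr (q - 1))) * ?U"
      proof (rule mult_right_mono_neg)
        have "u x powr (p - 1) * v x powr q \<le> (\<rho> powr - a) powr (p - 1) * (\<rho> powr - b) powr q"
          using u_decay v_decay pos pq by (intro mult_mono powr_mono2) (auto simp: less_imp_le)
        also have "\<dots> = \<rho> powr - \<mu>"
          by (simp add: powr_powr powr_add[symmetric] \<mu>_def algebra_simps)
        finally have 1: "u x powr (p - 1) * v x powr q \<le> \<rho> powr - \<mu>" .
        have "u x powr p * v x powr (q - 1) \<le> (\<rho> powr - a) powr p * (\<rho> powr - b) powr (q - 1)"
          using u_decay v_decay pos pq by (intro mult_mono powr_mono2) (auto simp: less_imp_le)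
        also have "\<dots> = \<rho> powr - \<nu>"
          by (simp add: powr_powr powr_add[symmetric] \<nu>_def algebra_simps)
        finally have 2: "u x powr p * v x powr (q - 1) \<le> \<rho> powr - \<nu>" .
        from 1 2 show "u x powr (p - 1) * v x powr q + 2 * (u x powr p * v x powr (q - 1))
          \<le> \<rho> powr - \<mu> + 2 * \<rho> powr - \<nu>" by linarith
      qed (use neg in simp)
      moreover have "\<kappa> * \<rho> powr - \<alpha> * ?U < (\<rho> powr - \<mu> + 2 * \<rho> powr - \<nu>) * ?U"
        using R[OF \<rho>(2)] neg by (intro mult_strict_right_mono_neg) auto
      moreover have "f (u ?x') (v ?x') - f (u x) (v x) \<le> \<kappa> * \<rho> powr - \<alpha> * ?U"
      proof -
        have "- (x \<bullet> e) \<le> norm x * norm e"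
          using Cauchy_Schwarz_ineq2[of x e] by linarith
        then have "l - x \<bullet> e \<le> \<rho>" using l e by (simp add: \<rho>_def)
        then have "\<rho> powr - \<alpha> \<le> (l - x \<bullet> e) powr - \<alpha>"
          using xl alpha by (intro powr_mono2') auto
        then have "\<kappa> * (l - x \<bullet> e) powr - \<alpha> * ?U \<le> \<kappa> * \<rho> powr - \<alpha> * ?U"
          using \<kappa> neg by (intro mult_right_mono_neg mult_left_mono) auto
        moreover have "frac_laplacian C \<alpha> u ?x' - frac_laplacian C \<alpha> u x \<le> \<kappa> * (l - x \<bullet> e) powr - \<alpha> * ?U"
          unfolding \<kappa>_def using min closed
          by (intro frac_laplacian_reflected_difference_le C alpha e xl u neg) (auto simp: inner_commute)
        ultimately show ?thesis by (simp add: eq_u)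
      qed
      ultimately show False by (simp add: refl_diff_def)
    qed
  qed simp
qed

theorem proposition9:
  fixes C \<alpha> a b p q r s :: real
    and f g :: "real \<Rightarrow> real \<Rightarrow> real"
    and u v :: "real ^ 'n \<Rightarrow> real"
    and e :: "real ^ 'n"
  assumes C: "C > 0"
    and alpha: "0 < \<alpha>" "\<alpha> < 2"
    and e: "norm e = 1"
    and f: "C1_on ({0..} \<times> {0..}) (\<lambda>(s, t). f s t)"
    and g: "C1_on ({0..} \<times> {0..}) (\<lambda>(s, t). g s t)"
    and u: "u \<in> L_space \<alpha>" "C11_loc u"
    and v: "v \<in> L_space \<alpha>" "C11_loc v"
    and eq_u: "\<And>x. frac_laplacian C \<alpha> u x = f (u x) (v x)"
    and eq_v: "\<And>x. frac_laplacian C \<alpha> v x = g (u x) (v x)"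
    and pos: "\<And>x. u x > 0" "\<And>x. v x > 0"
    and ab: "a > 0" "b > 0"
    and pqrs: "p \<ge> 1" "q \<ge> 1" "r \<ge> 1" "s \<ge> 1"
    and i: "lesssim_infinity u (\<lambda>x. norm x powr (- a))"
           "lesssim_infinity v (\<lambda>x. norm x powr (- b))"
    and ii: "lesssim_origin (partial1 f) (\<lambda>u v. u powr (p - 1) * v powr q)"
            "lesssim_origin (partial2 g) (\<lambda>u v. u powr r * v powr (s - 1))"
    and iii: "lesssim_origin (partial2 f) (\<lambda>u v. u powr p * v powr (q - 1))"
             "lesssim_origin (partial1 g) (\<lambda>u v. u powr (r - 1) * v powr s)"
    and iv: "\<And>u v. u > 0 \<Longrightarrow> v > 0 \<Longrightarrow> partial2 f u v > 0"
            "\<And>u v. u > 0 \<Longrightarrow> v > 0 \<Longrightarrow> partial1 g u v > 0"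
    and v_exponents: "\<alpha> < Min {a * p + b * q - a, a * p + b * q - b,
                     a * r + b * s - a, a * r + b * s - b}"
  shows "\<exists>R0>0. \<forall>l\<le>0.
    (\<forall>x \<in> halfspace e l.
       norm x > R0 \<and>
       (\<forall>z \<in> closure (halfspace e l). refl_diff e l u x \<le> refl_diff e l u z) \<and>
       refl_diff e l u x < 0
       \<longrightarrow> refl_diff e l v x < 2 * refl_diff e l u x \<and> 2 * refl_diff e l u x < 0) \<and>
    (\<forall>y \<in> halfspace e l.
       norm y > R0 \<and>
       (\<forall>z \<in> closure (halfspace e l). refl_diff e l v y \<le> refl_diff e l v z) \<and>
       refl_diff e l v y < 0
       \<longrightarrow> refl_diff e l u y < 2 * refl_diff e l v y \<and> 2 * refl_diff e l v y < 0)"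
proof -
  have exponents: "\<alpha> < a * p + b * q - a" "\<alpha> < a * p + b * q - b"
    "\<alpha> < b * s + a * r - b" "\<alpha> < b * s + a * r - a"
    using v_exponents by (simp_all add: algebra_simps)
  define h where "h s t = g t s" for s t
  have partials_h: "partial1 h s t = partial2 g t s" "partial2 h s t = partial1 g t s" for s t
    by (simp_all add: h_def partial1_def partial2_def)
  have u_min: "\<exists>R0>0. \<forall>l\<le>0. \<forall>x \<in> halfspace e l. norm x > R0 \<and>
      (\<forall>z \<in> closure (halfspace e l). refl_diff e l u x \<le> refl_diff e l u z) \<and>
      refl_diff e l u x < 0 \<longrightarrow> refl_diff e l v x < 2 * refl_diff e l u x"
    by (rule decay_forces_partner_below[OF C alpha e C1_on_quadrant_partials[OF f] u eq_u pos ab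
          pqrs(1,2) i ii(1) iii(1) iv(1) exponents(1,2)])
  have growth_h: "lesssim_origin (partial1 h) (\<lambda>s' t. s' powr (s - 1) * t powr r)"
    "lesssim_origin (partial2 h) (\<lambda>s' t. s' powr s * t powr (r - 1))"
    using ii(2) iii(2) unfolding lesssim_origin_def partials_h by (metis add.commute mult.commute)+
  have v_min: "\<exists>R0>0. \<forall>l\<le>0. \<forall>x \<in> halfspace e l. norm x > R0 \<and>
      (\<forall>z \<in> closure (halfspace e l). refl_diff e l v x \<le> refl_diff e l v z) \<and>
      refl_diff e l v x < 0 \<longrightarrow> refl_diff e l u x < 2 * refl_diff e l v x"
  proof (rule decay_forces_partner_below[OF C alpha e _ _ v _ pos(2,1) ab(2,1) pqrs(4,3) i(2,1)
          growth_h _ exponents(3,4)])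
    show "frac_laplacian C \<alpha> v x = h (v x) (u x)" for x by (simp add: eq_v h_def)
    show "((\<lambda>s. h s t) has_real_derivative partial1 h s t) (at s)" if "s > 0" "t > 0" for s t
      unfolding partials_h h_def using that by (intro C1_on_quadrant_partials[OF g])
    show "((\<lambda>t. h s t) has_real_derivative partial2 h s t) (at t)" if "s > 0" "t > 0" for s t
      unfolding partials_h h_def using that by (intro C1_on_quadrant_partials[OF g])
    show "partial2 h s t > 0" if "s > 0" "t > 0" for s t
      unfolding partials_h using that by (intro iv(2))
  qed
  obtain Ru where Ru: "Ru > 0" "\<forall>l\<le>0. \<forall>x \<in> halfspace e l. norm x > Ru \<and>
      (\<forall>z \<in> closure (halfspace e l). refl_diff e l u x \<le> refl_diff e l u z) \<and>
      refl_diff e l u x < 0 \<longrightarrow> refl_diff e l v x < 2 * refl_diff e l u x"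
    using u_min by blast
  obtain Rv where Rv: "Rv > 0" "\<forall>l\<le>0. \<forall>x \<in> halfspace e l. norm x > Rv \<and>
      (\<forall>z \<in> closure (halfspace e l). refl_diff e l v x \<le> refl_diff e l v z) \<and>
      refl_diff e l v x < 0 \<longrightarrow> refl_diff e l u x < 2 * refl_diff e l v x"
    using v_min by blast
  show ?thesis
    using Ru Rv by (intro exI[of _ "max Ru Rv"]) auto
qed

end
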